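(* There is a unique homomorphism $\eta:\mathbf{SB}(S_n)\to\mathbf{Bin}_n$ such that $$\eta(\sigma_{s_i})=s_i\quad\text{and}\quad \eta(\tau_{s_i})=\mathbf{s}_i,\qquad\text{for } i=1,2,\dots,n-1.$$
   Context: The singular Artin monoid $\mathbf{SB}(S_n)$ of type $A_{n-1}$ (the singular braid monoid on $n$ strands) is the monoid generated by invertible elements $\sigma_i=\sigma_{s_i}$ and elements $\tau_i=\tau_{s_i}$, $1\le i\le n-1$, subject to: $\sigma_i\sigma_j\sigma_i=\sigma_j\sigma_i\sigma_j$ and $\tau_i\sigma_j\sigma_i=\sigma_j\sigma_i\tau_j$ for $|i-j|=1$; $\sigma_i\sigma_j=\sigma_j\sigma_i$, $\tau_i\sigma_j=\sigma_j\tau_i$ and $\tau_i\tau_j=\tau_j\tau_i$ for $|i-j|>1$; and $\tau_i\sigma_i=\sigma_i\tau_i$ for all $i$. $\mathbf{Bin}_n$ is the monoid of all binary relations on $\underline{n}=\{1,2,\dots,n\}$, identified with $n\times n$ matrices over the Boolean semiring, the operation being matrix multiplication. The symmetric group $S_n$ is the group of invertible elements of $\mathbf{Bin}_n$, and $s_i$ denotes the transposition $(i,i+1)$. The relation $\mathbf{s}_i$ is obtained from the equality relation by adding the pairs $(i,i+1)$ and $(i+1,i)$. *)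

theory Defs
  imports "HOL-Algebra.Group" "HOL-Combinatorics.Transposition"
begin

inductive_set pres_cong :: "'g set \<Rightarrow> ('g list \<times> 'g list) set \<Rightarrow> ('g list \<times> 'g list) set"
  for A :: "'g set" and R :: "('g list \<times> 'g list) set"
where
  base: "(u, v) \<in> R \<Longrightarrow> u \<in> lists A \<Longrightarrow> v \<in> lists A \<Longrightarrow> (u, v) \<in> pres_cong A R"
| refl: "u \<in> lists A \<Longrightarrow> (u, u) \<in> pres_cong A R"
| sym: "(u, v) \<in> pres_cong A R \<Longrightarrow> (v, u) \<in> pres_cong A R"
| trans: "(u, v) \<in> pres_cong A R \<Longrightarrow> (v, w) \<in> pres_cong A R \<Longrightarrow> (u, w) \<in> pres_cong A R"
| append: "(u, v) \<in> pres_cong A R \<Longrightarrow> (u', v') \<in> pres_cong A R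
    \<Longrightarrow> (u @ u', v @ v') \<in> pres_cong A R"

definition pres_class :: "'g set \<Rightarrow> ('g list \<times> 'g list) set \<Rightarrow> 'g list \<Rightarrow> 'g list set" where
  "pres_class A R w = pres_cong A R `` {w}"

definition pres_monoid :: "'g set \<Rightarrow> ('g list \<times> 'g list) set \<Rightarrow> 'g list set monoid" where
  "pres_monoid A R =
    \<lparr>carrier = lists A // pres_cong A R,
     mult = (\<lambda>X Y. pres_cong A R `` {u @ v |u v. u \<in> X \<and> v \<in> Y}),
     one = pres_class A R []\<rparr>"

lemma pres_cong_lists: "(u, v) \<in> pres_cong A R \<Longrightarrow> u \<in> lists A \<and> v \<in> lists A"
  by (induction rule: pres_cong.induct) auto

lemma equiv_pres_cong: "equiv (lists A) (pres_cong A R)"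
proof (rule equivI)
  show "pres_cong A R \<subseteq> lists A \<times> lists A"
    using pres_cong_lists by fast
  show "refl_on (lists A) (pres_cong A R)"
    by (auto intro!: refl_onI pres_cong.refl)
  show "sym (pres_cong A R)"
    by (rule symI) (rule pres_cong.sym)
  show "trans (pres_cong A R)"
    by (rule transI) (rule pres_cong.trans)
qed

lemma carrier_pres_monoid: "carrier (pres_monoid A R) = pres_class A R ` lists A"
  by (auto simp: pres_monoid_def pres_class_def quotient_def)

lemma mult_pres_class:
  assumes "u \<in> lists A" "v \<in> lists A"
  shows "pres_class A R u \<otimes>\<^bsub>pres_monoid A R\<^esub> pres_class A R v = pres_class A R (u @ v)"
proof -
  have "(u @ v, w) \<in> pres_cong A R"
    if "(u, u') \<in> pres_cong A R" "(v, v') \<in> pres_cong A R" "(u' @ v', w) \<in> pres_cong A R"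
    for u' v' w
    using that by (blast intro: pres_cong.trans pres_cong.append)
  then show ?thesis
    using assms by (auto simp: pres_monoid_def pres_class_def intro: pres_cong.refl)
qed

lemma monoid_pres_monoid: "monoid (pres_monoid A R)" (is "monoid ?M")
proof (rule monoidI)
  have one: "\<one>\<^bsub>?M\<^esub> = pres_class A R []"
    by (simp add: pres_monoid_def)
  show "\<one>\<^bsub>?M\<^esub> \<in> carrier ?M"
    by (simp add: one carrier_pres_monoid)
  fix x assume "x \<in> carrier ?M"
  then obtain u where u: "u \<in> lists A" "x = pres_class A R u"
    by (auto simp: carrier_pres_monoid)
  show "\<one>\<^bsub>?M\<^esub> \<otimes>\<^bsub>?M\<^esub> x = x" "x \<otimes>\<^bsub>?M\<^esub> \<one>\<^bsub>?M\<^esub> = x"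
    using mult_pres_class[of "[]" A u R] mult_pres_class[of u A "[]" R] u by (simp_all add: one)
  fix y assume "y \<in> carrier ?M"
  then obtain v where v: "v \<in> lists A" "y = pres_class A R v"
    by (auto simp: carrier_pres_monoid)
  have "u @ v \<in> lists A"
    using u v by simp
  then show "x \<otimes>\<^bsub>?M\<^esub> y \<in> carrier ?M"
    using u v by (simp only: mult_pres_class carrier_pres_monoid) blast
  fix z assume "z \<in> carrier ?M"
  then obtain w where w: "w \<in> lists A" "z = pres_class A R w"
    by (auto simp: carrier_pres_monoid)
  have "v @ w \<in> lists A"
    using v w by simp
  with \<open>u @ v \<in> lists A\<close> show "x \<otimes>\<^bsub>?M\<^esub> y \<otimes>\<^bsub>?M\<^esub> z = x \<otimes>\<^bsub>?M\<^esub> (y \<otimes>\<^bsub>?M\<^esub> z)"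
    using u v w by (simp only: mult_pres_class append_assoc)
qed

text \<open>
  Invertibility of \<open>\<sigma>\<^sub>i\<close> is built into the presentation by a formal inverse
  generator \<open>SigInv i\<close> and the two cancellation relations.
\<close>

datatype sb_gen = Sig nat | SigInv nat | Tau nat

definition sb_gens :: "nat \<Rightarrow> sb_gen set" where
  "sb_gens n = Sig ` {1..n-1} \<union> SigInv ` {1..n-1} \<union> Tau ` {1..n-1}"

inductive_set sb_rels :: "nat \<Rightarrow> (sb_gen list \<times> sb_gen list) set" for n :: nat
where
  inv_right: "i \<in> {1..n-1} \<Longrightarrow> ([Sig i, SigInv i], []) \<in> sb_rels n"
| inv_left: "i \<in> {1..n-1} \<Longrightarrow> ([SigInv i, Sig i], []) \<in> sb_rels n"
| braid: "i \<in> {1..n-1} \<Longrightarrow> j \<in> {1..n-1} \<Longrightarrow> \<bar>int i - int j\<bar> = 1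
    \<Longrightarrow> ([Sig i, Sig j, Sig i], [Sig j, Sig i, Sig j]) \<in> sb_rels n"
| mixed_braid: "i \<in> {1..n-1} \<Longrightarrow> j \<in> {1..n-1} \<Longrightarrow> \<bar>int i - int j\<bar> = 1
    \<Longrightarrow> ([Tau i, Sig j, Sig i], [Sig j, Sig i, Tau j]) \<in> sb_rels n"
| comm_sigma_sigma: "i \<in> {1..n-1} \<Longrightarrow> j \<in> {1..n-1} \<Longrightarrow> \<bar>int i - int j\<bar> > 1
    \<Longrightarrow> ([Sig i, Sig j], [Sig j, Sig i]) \<in> sb_rels n"
| comm_tau_sigma: "i \<in> {1..n-1} \<Longrightarrow> j \<in> {1..n-1} \<Longrightarrow> \<bar>int i - int j\<bar> > 1
    \<Longrightarrow> ([Tau i, Sig j], [Sig j, Tau i]) \<in> sb_rels n"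
| comm_tau_tau: "i \<in> {1..n-1} \<Longrightarrow> j \<in> {1..n-1} \<Longrightarrow> \<bar>int i - int j\<bar> > 1
    \<Longrightarrow> ([Tau i, Tau j], [Tau j, Tau i]) \<in> sb_rels n"
| comm_same: "i \<in> {1..n-1} \<Longrightarrow> ([Tau i, Sig i], [Sig i, Tau i]) \<in> sb_rels n"

definition SB :: "nat \<Rightarrow> sb_gen list set monoid" where
  "SB n = pres_monoid (sb_gens n) (sb_rels n)"

definition sb_sigma :: "nat \<Rightarrow> nat \<Rightarrow> sb_gen list set" where
  "sb_sigma n i = pres_class (sb_gens n) (sb_rels n) [Sig i]"

definition sb_tau :: "nat \<Rightarrow> nat \<Rightarrow> sb_gen list set" where
  "sb_tau n i = pres_class (sb_gens n) (sb_rels n) [Tau i]"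

lemma monoid_SB: "monoid (SB n)"
  by (simp add: SB_def monoid_pres_monoid)

text \<open>
  A relation \<open>r\<close> is identified with the Boolean matrix whose \<open>(x, y)\<close> entry is
  \<open>(x, y) \<in> r\<close>; \<open>r O s\<close> is then the matrix product \<open>r \<cdot> s\<close>, in this order.
\<close>

definition Bin :: "nat \<Rightarrow> (nat \<times> nat) set monoid" where
  "Bin n = \<lparr>carrier = Pow ({1..n} \<times> {1..n}), mult = (O), one = Id_on {1..n}\<rparr>"

lemma monoid_Bin: "monoid (Bin n)"
  by (rule monoidI) (auto simp: Bin_def)

text \<open>
  The embedding of permutations of \<open>{1..n}\<close> into \<open>Bin n\<close>.  Reading the matrix of a
  permutation by columns instead of rows would give the inverse permutation, hence the
  same relation for a transposition.
\<close>

definition perm_rel :: "nat \<Rightarrow> (nat \<Rightarrow> nat) \<Rightarrow> (nat \<times> nat) set" where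
  "perm_rel n p = {(x, p x) |x. x \<in> {1..n}}"

definition bin_s :: "nat \<Rightarrow> nat \<Rightarrow> (nat \<times> nat) set" where
  "bin_s n i = perm_rel n (Transposition.transpose i (i + 1))"

definition bin_bold_s :: "nat \<Rightarrow> nat \<Rightarrow> (nat \<times> nat) set" where
  "bin_bold_s n i = Id_on {1..n} \<union> {(i, i + 1), (i + 1, i)}"

text \<open>
  The library's \<open>hom\<close> does not require preservation of the unit.  Restricting to
  extensional functions makes equality of functions mean equality on the carrier.
\<close>

definition monoid_hom :: "('a, 'c) monoid_scheme \<Rightarrow> ('b, 'd) monoid_scheme \<Rightarrow> ('a \<Rightarrow> 'b) set" where
  "monoid_hom M N = {h \<in> hom M N. h \<one>\<^bsub>M\<^esub> = \<one>\<^bsub>N\<^esub>} \<inter> extensional (carrier M)"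

end

theory Submission imports Defs begin

text \<open>
  A homomorphism out of a monoid given by generators and relations is the same thing as an
  assignment of values to the generators under which the two sides of every defining relation
  get the same value (\<open>pres_monoid_hom_exists\<close>, \<open>pres_monoid_hom_unique\<close>).

  For existence, the values must satisfy the defining relations of the singular braid monoid.
  The point is that, with addition of Boolean matrices being union of relations,
  \<open>bin_bold_s n i\<close> is \<open>1 + bin_s n i\<close>, and multiplication distributes over addition.  So every
  relation that involves a \<open>\<tau>\<close> expands into relations between the transpositions alone; for
  instance, if \<open>i\<close> and \<open>j\<close> are neighbours, then
  \<open>(1 + s\<^sub>i) s\<^sub>j s\<^sub>i = s\<^sub>j s\<^sub>i + s\<^sub>i s\<^sub>j s\<^sub>i = s\<^sub>j s\<^sub>i + s\<^sub>j s\<^sub>i s\<^sub>j = s\<^sub>j s\<^sub>i (1 + s\<^sub>j)\<close>.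
  What remains are the Coxeter relations of the symmetric group.

  For uniqueness, the \<open>\<sigma>\<^sub>i\<close> and \<open>\<tau>\<^sub>i\<close> generate only together with the inverses of the \<open>\<sigma>\<^sub>i\<close>, but
  a unit-preserving homomorphism carries inverses to inverses, and inverses in a monoid are
  unique, so its values on the \<open>\<sigma>\<^sub>i\<close> determine those on their inverses.
\<close>

section \<open>Homomorphisms out of a presented monoid\<close>

definition word_value :: "('b, 'd) monoid_scheme \<Rightarrow> ('g \<Rightarrow> 'b) \<Rightarrow> 'g list \<Rightarrow> 'b" where
  "word_value N f w = foldr (\<lambda>g x. f g \<otimes>\<^bsub>N\<^esub> x) w \<one>\<^bsub>N\<^esub>"

lemma word_value_Nil [simp]: "word_value N f [] = \<one>\<^bsub>N\<^esub>"
  by (simp add: word_value_def)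

lemma word_value_Cons [simp]: "word_value N f (g # w) = f g \<otimes>\<^bsub>N\<^esub> word_value N f w"
  by (simp add: word_value_def)

context monoid
begin

lemma word_value_closed:
  assumes "f \<in> A \<rightarrow> carrier G" "w \<in> lists A"
  shows "word_value G f w \<in> carrier G"
  using assms(2) by induction (use assms(1) in auto)

lemma word_value_append:
  assumes "f \<in> A \<rightarrow> carrier G" "u \<in> lists A" "v \<in> lists A"
  shows "word_value G f (u @ v) = word_value G f u \<otimes> word_value G f v"
  using assms(2)
proof induction
  case Nil
  show ?case using word_value_closed[OF assms(1,3)] by simp
next
  case (Cons g u)
  moreover have "f g \<in> carrier G" using assms(1) Cons.hyps(1) by auto
  ultimately show ?case
    using word_value_closed[OF assms(1)] assms(3) by (simp add: m_assoc)
qed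

lemma word_value_pres_cong:
  assumes f: "f \<in> A \<rightarrow> carrier G"
    and rels: "\<And>u v. (u, v) \<in> R \<Longrightarrow> word_value G f u = word_value G f v"
    and "(u, v) \<in> pres_cong A R"
  shows "word_value G f u = word_value G f v"
  using assms(3)
proof induction
  case (append u v u' v')
  then show ?case
    using pres_cong_lists[OF append.hyps(1)] pres_cong_lists[OF append.hyps(2)]
    by (simp add: word_value_append[OF f])
qed (simp_all add: rels)

end

lemma pres_class_eq_iff:
  assumes "u \<in> lists A" "v \<in> lists A"
  shows "pres_class A R u = pres_class A R v \<longleftrightarrow> (u, v) \<in> pres_cong A R"
  unfolding pres_class_def using equiv_pres_cong assms by (rule eq_equiv_class_iff)

lemma one_pres_monoid: "\<one>\<^bsub>pres_monoid A R\<^esub> = pres_class A R []"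
  by (simp add: pres_monoid_def)

lemma pres_class_carrier: "w \<in> lists A \<Longrightarrow> pres_class A R w \<in> carrier (pres_monoid A R)"
  by (simp add: carrier_pres_monoid)

text \<open>
  Evaluation of words is constant on congruence classes, because the congruence is the smallest
  one containing the relations; the homomorphism evaluates any representative.
\<close>

lemma pres_monoid_hom_exists:
  assumes N: "monoid N"
    and f: "f \<in> A \<rightarrow> carrier N"
    and rels: "\<And>u v. (u, v) \<in> R \<Longrightarrow> word_value N f u = word_value N f v"
  shows "\<exists>h \<in> monoid_hom (pres_monoid A R) N. \<forall>a\<in>A. h (pres_class A R [a]) = f a"
proof -
  interpret monoid N by (rule N)
  let ?M = "pres_monoid A R"
  define h where "h = restrict (\<lambda>X. word_value N f (SOME w. w \<in> lists A \<and> X = pres_class A R w))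
    (carrier ?M)"
  have h: "h (pres_class A R w) = word_value N f w" if w: "w \<in> lists A" for w
  proof -
    let ?v = "SOME v. v \<in> lists A \<and> pres_class A R w = pres_class A R v"
    have "?v \<in> lists A \<and> pres_class A R w = pres_class A R ?v"
      by (rule someI[of _ w]) (use w in simp)
    then have "(w, ?v) \<in> pres_cong A R"
      using w by (metis pres_class_eq_iff)
    then have "word_value N f w = word_value N f ?v"
      using word_value_pres_cong[OF f rels] by blast
    then show ?thesis
      using w by (simp add: h_def pres_class_carrier)
  qed
  have "h \<in> hom ?M N"
  proof (rule homI)
    fix x assume "x \<in> carrier ?M"
    then obtain u where u: "u \<in> lists A" "x = pres_class A R u"
      by (auto simp: carrier_pres_monoid)
    then show "h x \<in> carrier N"
      by (simp add: h word_value_closed[OF f])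
    fix y assume "y \<in> carrier ?M"
    then obtain v where v: "v \<in> lists A" "y = pres_class A R v"
      by (auto simp: carrier_pres_monoid)
    have "u @ v \<in> lists A" using u v by simp
    then show "h (x \<otimes>\<^bsub>?M\<^esub> y) = h x \<otimes>\<^bsub>N\<^esub> h y"
      using u v by (simp only: mult_pres_class h word_value_append[OF f])
  qed
  moreover have "h \<one>\<^bsub>?M\<^esub> = \<one>\<^bsub>N\<^esub>"
    by (simp add: one_pres_monoid h)
  moreover have "h \<in> extensional (carrier ?M)"
    by (simp add: h_def)
  ultimately have "h \<in> monoid_hom ?M N"
    by (simp add: monoid_hom_def)
  moreover have "h (pres_class A R [a]) = f a" if "a \<in> A" for a
  proof -
    have "f a \<in> carrier N" using f that by auto
    then show ?thesis using that by (simp add: h)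
  qed
  ultimately show ?thesis by blast
qed

lemma pres_monoid_hom_unique:
  assumes h: "h \<in> monoid_hom (pres_monoid A R) N"
    and k: "k \<in> monoid_hom (pres_monoid A R) N"
    and gens: "\<And>a. a \<in> A \<Longrightarrow> h (pres_class A R [a]) = k (pres_class A R [a])"
  shows "h = k"
proof (rule extensionalityI)
  let ?M = "pres_monoid A R"
  show "h \<in> extensional (carrier ?M)" "k \<in> extensional (carrier ?M)"
    using h k by (simp_all add: monoid_hom_def)
  have "h (pres_class A R w) = k (pres_class A R w)" if "w \<in> lists A" for w
    using that
  proof induction
    case Nil
    then show ?case
      using h k by (simp add: monoid_hom_def flip: one_pres_monoid)
  next
    case (Cons a w)
    have a: "[a] \<in> lists A" using Cons.hyps by simp
    have mult: "p (pres_class A R (a # w)) = p (pres_class A R [a]) \<otimes>\<^bsub>N\<^esub> p (pres_class A R w)"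
      if "p \<in> monoid_hom ?M N" for p
    proof -
      have "p \<in> hom ?M N" using that by (simp add: monoid_hom_def)
      then show ?thesis
        using hom_mult[of p ?M N, OF _ pres_class_carrier[OF a] pres_class_carrier[OF Cons.hyps(2)]]
        by (simp only: mult_pres_class[OF a Cons.hyps(2)] append_Cons append_Nil)
    qed
    then show ?case
      by (simp only: mult[OF h] mult[OF k] gens[OF Cons.hyps(1)] Cons.IH)
  qed
  then show "h x = k x" if "x \<in> carrier ?M" for x
    using that by (auto simp: carrier_pres_monoid)
qed

text \<open>
  Both \<open>h y\<close> and \<open>k y\<close> are inverse to \<open>h x = k x\<close>.  This lets the values on the \<open>\<sigma>\<^sub>i\<close> fix those
  on their formal inverses.
\<close>

lemma monoid_hom_eq_on_inverse:
  assumes M: "monoid M" and N: "monoid N"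
    and h: "h \<in> monoid_hom M N" and k: "k \<in> monoid_hom M N"
    and x: "x \<in> carrier M" and y: "y \<in> carrier M"
    and xy: "x \<otimes>\<^bsub>M\<^esub> y = \<one>\<^bsub>M\<^esub>" and yx: "y \<otimes>\<^bsub>M\<^esub> x = \<one>\<^bsub>M\<^esub>"
    and eq: "h x = k x"
  shows "h y = k y"
proof (rule monoid.inv_unique[OF N])
  have hom: "h \<in> hom M N" "k \<in> hom M N" and one: "h \<one>\<^bsub>M\<^esub> = \<one>\<^bsub>N\<^esub>" "k \<one>\<^bsub>M\<^esub> = \<one>\<^bsub>N\<^esub>"
    using h k by (simp_all add: monoid_hom_def)
  show "h y \<otimes>\<^bsub>N\<^esub> h x = \<one>\<^bsub>N\<^esub>"
    using hom_mult[OF hom(1) y x] yx one by simp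
  show "h x \<otimes>\<^bsub>N\<^esub> k y = \<one>\<^bsub>N\<^esub>"
    using hom_mult[OF hom(2) x y] xy one eq by simp
  show "h x \<in> carrier N" "h y \<in> carrier N" "k y \<in> carrier N"
    using hom x y by (auto intro: hom_in_carrier)
qed

section \<open>Coxeter relations among the transposition matrices\<close>

lemma carrier_Bin [simp]: "carrier (Bin n) = Pow ({1..n} \<times> {1..n})"
  and mult_Bin [simp]: "r \<otimes>\<^bsub>Bin n\<^esub> s = r O s"
  and one_Bin [simp]: "\<one>\<^bsub>Bin n\<^esub> = Id_on {1..n}"
  by (simp_all add: Bin_def)

lemma bin_s_subset: "i \<in> {1..n-1} \<Longrightarrow> bin_s n i \<subseteq> {1..n} \<times> {1..n}"
  by (auto simp: bin_s_def perm_rel_def Transposition.transpose_def)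

lemma perm_rel_comp:
  assumes "p ` {1..n} \<subseteq> {1..n}"
  shows "perm_rel n p O perm_rel n q = perm_rel n (q \<circ> p)"
  using assms by (force simp: perm_rel_def image_subset_iff)

lemma perm_rel_transpose_comp:
  assumes "i \<in> {1..n-1}"
  shows "bin_s n i O perm_rel n q = perm_rel n (q \<circ> Transposition.transpose i (i + 1))"
  unfolding bin_s_def
  by (rule perm_rel_comp) (use assms in \<open>auto simp: Transposition.transpose_def\<close>)

lemma bin_s_involution:
  assumes "i \<in> {1..n-1}"
  shows "bin_s n i O bin_s n i = Id_on {1..n}"
proof -
  have "bin_s n i O bin_s n i = perm_rel n id"
    using perm_rel_transpose_comp[OF assms] by (simp add: bin_s_def)
  then show ?thesis by (auto simp: perm_rel_def)
qed

lemma bin_s_braid: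
  assumes i: "i \<in> {1..n-1}" and j: "j \<in> {1..n-1}" and adj: "\<bar>int i - int j\<bar> = 1"
  shows "bin_s n i O bin_s n j O bin_s n i = bin_s n j O bin_s n i O bin_s n j"
proof -
  let ?t = "\<lambda>k. Transposition.transpose k (k + 1)"
  have "?t i \<circ> ?t j \<circ> ?t i = ?t j \<circ> ?t i \<circ> ?t j"
    using adj by (auto simp: fun_eq_iff Transposition.transpose_def)
  then show ?thesis
    unfolding bin_s_def[of n i] bin_s_def[of n j]
    unfolding perm_rel_transpose_comp[OF i, unfolded bin_s_def]
      perm_rel_transpose_comp[OF j, unfolded bin_s_def]
    by simp
qed

lemma bin_s_commute:
  assumes i: "i \<in> {1..n-1}" and j: "j \<in> {1..n-1}" and far: "\<bar>int i - int j\<bar> > 1"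
  shows "bin_s n i O bin_s n j = bin_s n j O bin_s n i"
proof -
  let ?t = "\<lambda>k. Transposition.transpose k (k + 1)"
  have "?t j \<circ> ?t i = ?t i \<circ> ?t j"
    using far by (auto simp: fun_eq_iff Transposition.transpose_def)
  then show ?thesis
    unfolding bin_s_def[of n i] bin_s_def[of n j]
    unfolding perm_rel_transpose_comp[OF i, unfolded bin_s_def]
      perm_rel_transpose_comp[OF j, unfolded bin_s_def]
    by simp
qed

text \<open>
  The equality relation already contains what the transposition does outside
  \<open>{i, i + 1}\<close>, so adding the whole transposition adds only the two off-diagonal pairs.
\<close>

lemma bin_bold_s_eq_Un:
  assumes "i \<in> {1..n-1}"
  shows "bin_bold_s n i = Id_on {1..n} \<union> bin_s n i"
proof (rule Set.set_eqI)
  fix z :: "nat \<times> nat"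
  obtain x y where z: "z = (x, y)" by (cases z)
  show "z \<in> bin_bold_s n i \<longleftrightarrow> z \<in> Id_on {1..n} \<union> bin_s n i"
    using assms
    by (cases "x = i \<or> x = i + 1")
      (auto simp: z bin_bold_s_def bin_s_def perm_rel_def Transposition.transpose_def)
qed

section \<open>The images of the generators satisfy the relations of the singular braid monoid\<close>

text \<open>A transposition is its own inverse, so \<open>SigInv i\<close> has to get the same value as \<open>Sig i\<close>.\<close>

fun gen_rel :: "nat \<Rightarrow> sb_gen \<Rightarrow> (nat \<times> nat) set" where
  "gen_rel n (Sig i) = bin_s n i"
| "gen_rel n (SigInv i) = bin_s n i"
| "gen_rel n (Tau i) = bin_bold_s n i"

lemma gen_rel_closed: "gen_rel n \<in> sb_gens n \<rightarrow> carrier (Bin n)"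
proof
  fix g assume "g \<in> sb_gens n"
  then obtain i where i: "i \<in> {1..n-1}" and g: "g \<in> {Sig i, SigInv i, Tau i}"
    unfolding sb_gens_def by blast
  then show "gen_rel n g \<in> carrier (Bin n)"
    using bin_s_subset[OF i] by (auto simp only: gen_rel.simps bin_bold_s_eq_Un carrier_Bin)
qed

lemma gen_rel_respects_sb_rels:
  assumes "(u, v) \<in> sb_rels n"
  shows "word_value (Bin n) (gen_rel n) u = word_value (Bin n) (gen_rel n) v"
proof -
  have unit: "bin_s n i O Id_on {1..n} = bin_s n i" "Id_on {1..n} O bin_s n i = bin_s n i"
    if "i \<in> {1..n-1}" for i
    using monoid.r_one[OF monoid_Bin, of "bin_s n i" n] monoid.l_one[OF monoid_Bin, of "bin_s n i" n]
      bin_s_subset[OF that] by simp_all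
  have idem: "Id_on {1..n} O Id_on {1..n} = Id_on {1..n}"
    using monoid.l_one[OF monoid_Bin, of "Id_on {1..n}" n] by (simp add: Id_on_subset_Times)
  have unit_left: "Id_on {1..n} O bin_s n i O r = bin_s n i O r" if "i \<in> {1..n-1}" for i r
    using unit(2)[OF that] by (metis O_assoc)
  \<comment> \<open>Distributivity reduces each \<open>\<tau>\<close>-relation to the Coxeter relations; the two sides may
    then still differ in the order of the summands.\<close>
  note expand = bin_bold_s_eq_Un relcomp_distrib relcomp_distrib2 unit unit_left idem O_assoc
  \<comment> \<open>Keeps \<open>Id_on {1..n}\<close> in the form in which the rules above mention it.\<close>
  note [simp del] = One_nat_def
  show ?thesis
    using assms
  proof cases
    case (inv_right i)
    then show ?thesis by (simp add: unit bin_s_involution)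
  next
    case (inv_left i)
    then show ?thesis by (simp add: unit bin_s_involution)
  next
    case (braid i j)
    then show ?thesis by (simp add: unit bin_s_braid)
  next
    case (mixed_braid i j)
    then show ?thesis using bin_s_braid[of i n j] by (simp add: expand)
  next
    case (comm_sigma_sigma i j)
    then show ?thesis using bin_s_commute[of i n j] by (simp add: unit)
  next
    case (comm_tau_sigma i j)
    then show ?thesis using bin_s_commute[of i n j] by (simp add: expand)
  next
    case (comm_tau_tau i j)
    then show ?thesis using bin_s_commute[of i n j] by (simp add: expand Un_ac)
  next
    case (comm_same i)
    then show ?thesis by (simp add: expand)
  qed
qed

section \<open>The homomorphism to binary relations\<close>

lemma SB_hom_unique:
  assumes N: "monoid N"
    and h: "h \<in> monoid_hom (SB n) N" and k: "k \<in> monoid_hom (SB n) N"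
    and sigma: "\<And>i. i \<in> {1..n-1} \<Longrightarrow> h (sb_sigma n i) = k (sb_sigma n i)"
    and tau: "\<And>i. i \<in> {1..n-1} \<Longrightarrow> h (sb_tau n i) = k (sb_tau n i)"
  shows "h = k"
proof (rule pres_monoid_hom_unique[OF h[unfolded SB_def] k[unfolded SB_def]])
  let ?c = "pres_class (sb_gens n) (sb_rels n)"
  fix g assume "g \<in> sb_gens n"
  then consider i where "i \<in> {1..n-1}" "g = Sig i" | i where "i \<in> {1..n-1}" "g = SigInv i"
    | i where "i \<in> {1..n-1}" "g = Tau i"
    unfolding sb_gens_def by blast
  then show "h (?c [g]) = k (?c [g])"
  proof cases
    case (1 i)
    then show ?thesis using sigma by (simp add: sb_sigma_def)
  next
    case (3 i)
    then show ?thesis using tau by (simp add: sb_tau_def)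
  next
    case (2 i)
    have gens: "[Sig i] \<in> lists (sb_gens n)" "[SigInv i] \<in> lists (sb_gens n)"
      using 2 by (auto simp: sb_gens_def)
    have words: "[Sig i, SigInv i] \<in> lists (sb_gens n)" "[SigInv i, Sig i] \<in> lists (sb_gens n)"
      using gens by simp_all
    have "([Sig i, SigInv i], []) \<in> pres_cong (sb_gens n) (sb_rels n)"
      and "([SigInv i, Sig i], []) \<in> pres_cong (sb_gens n) (sb_rels n)"
      using sb_rels.inv_right[OF 2(1)] sb_rels.inv_left[OF 2(1)] words
      by (blast intro: pres_cong.base)+
    then have "?c [Sig i, SigInv i] = ?c []" "?c [SigInv i, Sig i] = ?c []"
      using words by (simp_all only: pres_class_eq_iff lists.Nil)
    then have "?c [Sig i] \<otimes>\<^bsub>SB n\<^esub> ?c [SigInv i] = \<one>\<^bsub>SB n\<^esub>"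
      and "?c [SigInv i] \<otimes>\<^bsub>SB n\<^esub> ?c [Sig i] = \<one>\<^bsub>SB n\<^esub>"
      using gens by (simp_all add: SB_def mult_pres_class one_pres_monoid)
    moreover have "?c [Sig i] \<in> carrier (SB n)" "?c [SigInv i] \<in> carrier (SB n)"
      using gens by (simp_all only: SB_def pres_class_carrier)
    ultimately show ?thesis
      using monoid_hom_eq_on_inverse[OF monoid_SB N h k] sigma 2
      by (simp add: sb_sigma_def)
  qed
qed

theorem proposition6:
  fixes n :: nat
  assumes "n \<ge> 1"
  shows "\<exists>!\<eta>. \<eta> \<in> monoid_hom (SB n) (Bin n) \<and>
    (\<forall>i\<in>{1..n-1}. \<eta> (sb_sigma n i) = bin_s n i \<and> \<eta> (sb_tau n i) = bin_bold_s n i)"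
proof -
  have "\<exists>h \<in> monoid_hom (SB n) (Bin n). \<forall>g\<in>sb_gens n.
      h (pres_class (sb_gens n) (sb_rels n) [g]) = gen_rel n g"
    unfolding SB_def
    by (rule pres_monoid_hom_exists[OF monoid_Bin gen_rel_closed gen_rel_respects_sb_rels])
  then obtain \<eta> where \<eta>: "\<eta> \<in> monoid_hom (SB n) (Bin n)"
    and gens: "\<forall>g\<in>sb_gens n. \<eta> (pres_class (sb_gens n) (sb_rels n) [g]) = gen_rel n g"
    by (rule bexE)
  have on_gens: "\<eta> (sb_sigma n i) = bin_s n i \<and> \<eta> (sb_tau n i) = bin_bold_s n i"
    if "i \<in> {1..n-1}" for i
  proof -
    have "Sig i \<in> sb_gens n" "Tau i \<in> sb_gens n"
      using that by (simp_all add: sb_gens_def)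
    then show ?thesis
      using gens by (simp add: sb_sigma_def sb_tau_def)
  qed
  show ?thesis
  proof (rule ex1I[of _ \<eta>])
    show "\<eta> \<in> monoid_hom (SB n) (Bin n) \<and>
        (\<forall>i\<in>{1..n-1}. \<eta> (sb_sigma n i) = bin_s n i \<and> \<eta> (sb_tau n i) = bin_bold_s n i)"
      using \<eta> on_gens by simp
    fix \<theta> assume \<theta>: "\<theta> \<in> monoid_hom (SB n) (Bin n) \<and>
        (\<forall>i\<in>{1..n-1}. \<theta> (sb_sigma n i) = bin_s n i \<and> \<theta> (sb_tau n i) = bin_bold_s n i)"
    show "\<theta> = \<eta>"
      by (rule SB_hom_unique[OF monoid_Bin, of _ n n]) (use \<theta> \<eta> on_gens in auto)
  qed
qed

end
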